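(* Let $\Omega\subset\mathbb{R}^N$ be a bounded open set, $r>0$, $L>0$ and $C\subset\mathbb{R}^{N-1}$ a finite closed cone with vertex at $0$. Then there exist $r'>0$, $L'>0$ and $M_0\in\mathbb{N}$, with $r',L'$ depending only on $r,L,C$ and $M_0$ depending only on $r,L,C$ and the diameter of $\Omega$, such that every $K\in\mathcal{G}(r,L,C)$ belongs to $\mathcal{FR}(r',L',M_0)$.
   Context: Let $\pi=\{y\in\mathbb{R}^N:y_N=0\}$ (identified with $\mathbb{R}^{N-1}$) and $\pi^+=\{y\in\pi:y_{N-1}\ge0\}$. A finite closed cone with vertex $x$ is a set $x+(\overline{B_1}\cap\{\lambda y:y\in\overline{B_2},\lambda\ge0\})$ with $B_1,B_2$ open balls, $B_1$ centred at $0$, $0\notin B_2$; cones are congruent if related by a rigid motion. A nonempty compact $K\subset\overline\Omega$ is a Lipschitz hypersurface with constants $r,L$ if for each $x\in K$ there is $\Phi_x:B_r(x)\to\mathbb{R}^N$ with $L^{-1}|z_1-z_2|\le|\Phi_x(z_1)-\Phi_x(z_2)|\le L|z_1-z_2|$, $\Phi_x(x)=0$, $\Phi_x(K\cap B_r(x))\subset\pi$; $x$ is interior if $B_\delta(0)\cap\pi\subset\Phi_x(K\cap B_r(x))$ for some $\delta>0$; $\mathrm{bdry}(K)$ = non-interior points. $K\in\mathcal{G}(r,L,C)$ if it is such a Lipschitz hypersurface and for every $x\in K$ and $y\in B_{r/2}(x)\cap K$ there is a finite closed cone $C_y\subset\pi$ congruent to $C$ with $\Phi_x(y)\in C_y\subset\Phi_x(\overline{B_r(x)}\cap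 K)$. $K\in\mathcal{MR}(r,L)$ if it is a Lipschitz hypersurface with constants $r,L$ and $\Phi_x(K\cap B_r(x))=\Phi_x(B_r(x))\cap\pi^+$ for every $x\in\mathrm{bdry}(K)$. $K\in\mathcal{FR}(r,L,M_0)$ if $K$ is a Lipschitz hypersurface with constants $r,L$ and $K=\bigcup_{j=1}^JH^j$ with $H^j\in\mathcal{MR}(r,L)$ and $1\le J\le M_0$. *)

theory Defs
  imports "HOL-Analysis.Analysis"
begin

text \<open>Ambient space: real^'n with 'n a finite linearly ordered index type;
  the last coordinate (N) is Max UNIV, the coordinate N-1 is the largest
  remaining index.\<close>

definition idxN :: "'n::{finite,linorder}" where
  "idxN = Max UNIV"

definition idxN1 :: "'n::{finite,linorder}" where
  "idxN1 = Max (UNIV - {idxN})"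

definition piN :: "(real^('n::{finite,linorder})) set" where
  "piN = {y. y $ idxN = 0}"

definition piP :: "(real^('n::{finite,linorder})) set" where
  "piP = {y \<in> piN. y $ idxN1 \<ge> 0}"

text \<open>A finite closed cone in pi = R^{N-1} with vertex 0: balls B1 = ball 0 rho and
  B2 = ball c s of pi (c in pi), 0 not in B2.\<close>
definition pi_cone0 :: "(real^('n::{finite,linorder})) set \<Rightarrow> bool" where
  "pi_cone0 C \<longleftrightarrow> (\<exists>\<rho> c s. \<rho> > 0 \<and> s > 0 \<and> c \<in> piN \<and> norm c \<ge> s \<and>
      C = cball 0 \<rho> \<inter> piN \<inter> {t *\<^sub>R y | t y. t \<ge> 0 \<and> y \<in> cball c s \<inter> piN})"

definition congruent_sets :: "('a::metric_space) set \<Rightarrow> 'a set \<Rightarrow> bool" where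
  "congruent_sets A B \<longleftrightarrow> (\<exists>f. bij f \<and> (\<forall>x y. dist (f x) (f y) = dist x y) \<and> f ` A = B)"

text \<open>Lipschitz hypersurface with constants r, L (in closure Omega), w.r.t. a chosen
  family of charts Phi x.  Charts are bi-Lipschitz on the closed ball (i.e. the unique
  continuous extension of a bi-Lipschitz map on the open ball).\<close>
definition lip_charts ::
  "(real^('n::{finite,linorder})) set \<Rightarrow> real \<Rightarrow> real \<Rightarrow> (real^('n::{finite,linorder})) set
     \<Rightarrow> (real^('n::{finite,linorder}) \<Rightarrow> real^('n::{finite,linorder}) \<Rightarrow> real^('n::{finite,linorder})) \<Rightarrow> bool" where
  "lip_charts \<Omega> r L K \<Phi> \<longleftrightarrow> K \<noteq> {} \<and> compact K \<and> K \<subseteq> closure \<Omega> \<and>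
     (\<forall>x\<in>K. (\<forall>z1\<in>cball x r. \<forall>z2\<in>cball x r.
                 dist z1 z2 / L \<le> dist (\<Phi> x z1) (\<Phi> x z2) \<and>
                 dist (\<Phi> x z1) (\<Phi> x z2) \<le> L * dist z1 z2) \<and>
             \<Phi> x x = 0 \<and> \<Phi> x ` (K \<inter> ball x r) \<subseteq> piN)"

definition interior_pt ::
  "real \<Rightarrow> (real^('n::{finite,linorder})) set \<Rightarrow> (real^('n::{finite,linorder}) \<Rightarrow> real^('n::{finite,linorder}) \<Rightarrow> real^('n::{finite,linorder})) \<Rightarrow> real^('n::{finite,linorder}) \<Rightarrow> bool" where
  "interior_pt r K \<Phi> x \<longleftrightarrow> (\<exists>\<delta>>0. ball 0 \<delta> \<inter> piN \<subseteq> \<Phi> x ` (K \<inter> ball x r))"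

definition bdry ::
  "real \<Rightarrow> (real^('n::{finite,linorder})) set \<Rightarrow> (real^('n::{finite,linorder}) \<Rightarrow> real^('n::{finite,linorder}) \<Rightarrow> real^('n::{finite,linorder})) \<Rightarrow> (real^('n::{finite,linorder})) set" where
  "bdry r K \<Phi> = {x \<in> K. \<not> interior_pt r K \<Phi> x}"

definition classG ::
  "(real^('n::{finite,linorder})) set \<Rightarrow> real \<Rightarrow> real \<Rightarrow> (real^('n::{finite,linorder})) set \<Rightarrow> (real^('n::{finite,linorder})) set \<Rightarrow> bool" where
  "classG \<Omega> r L C K \<longleftrightarrow> (\<exists>\<Phi>. lip_charts \<Omega> r L K \<Phi> \<and>
     (\<forall>x\<in>K. \<forall>y\<in>ball x (r/2) \<inter> K. \<exists>Cy. Cy \<subseteq> piN \<and> congruent_sets Cy C \<and>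
         \<Phi> x y \<in> Cy \<and> Cy \<subseteq> \<Phi> x ` (cball x r \<inter> K)))"

definition classMR ::
  "(real^('n::{finite,linorder})) set \<Rightarrow> real \<Rightarrow> real \<Rightarrow> (real^('n::{finite,linorder})) set \<Rightarrow> bool" where
  "classMR \<Omega> r L K \<longleftrightarrow> (\<exists>\<Phi>. lip_charts \<Omega> r L K \<Phi> \<and>
     (\<forall>x\<in>bdry r K \<Phi>. \<Phi> x ` (K \<inter> ball x r) = \<Phi> x ` (ball x r) \<inter> piP))"

definition classFR ::
  "(real^('n::{finite,linorder})) set \<Rightarrow> real \<Rightarrow> real \<Rightarrow> nat \<Rightarrow> (real^('n::{finite,linorder})) set \<Rightarrow> bool" where
  "classFR \<Omega> r L M0 K \<longleftrightarrow> (\<exists>\<Phi>. lip_charts \<Omega> r L K \<Phi>) \<and>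
     (\<exists>J H. 1 \<le> J \<and> J \<le> M0 \<and> K = (\<Union>j<J. H j) \<and> (\<forall>j<J. classMR \<Omega> r L (H j)))"

end

theory Submission
  imports Defs
begin

text \<open>Fix a chart \<open>\<Phi> x\<close> and let \<open>Q \<subseteq> piN\<close> be the image of \<open>K\<close> near \<open>x\<close>. For a disc \<open>B\<close> of \<open>piN\<close> of
  fixed radius, the set \<open>S\<close> of points \<open>p\<close> all of whose segments to points of \<open>B\<close> lie in \<open>Q\<close> is
  compact and star-shaped with respect to \<open>B\<close>. Hence its relative boundary is locally a Lipschitz
  graph, with constants controlled by the radius of \<open>B\<close> and the diameter of \<open>S\<close>, and composing
  \<open>\<Phi> x\<close> with the shear that flattens this graph shows that the preimage of \<open>S\<close> is of class MR.
  The cone condition provides, for every \<open>y \<in> K\<close> near \<open>x\<close>, a convex subset of \<open>Q\<close> that contains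
  \<open>\<Phi> x y\<close> and a disc of fixed radius. So finitely many centres \<open>x\<close> and discs \<open>B\<close> suffice to
  cover \<open>K\<close>, and compactness bounds their number in terms of the diameter.\<close>

section \<open>Linear algebra in the hyperplane \<open>piN\<close>\<close>

lemma subspace_piN: "subspace piN"
  by (auto simp: subspace_def piN_def)

lemma closed_piN: "closed piN"
  by (simp add: closed_subspace subspace_piN)

text \<open>The reflection that exchanges \<omega> and the unit vector \<open>e\<close> of
  coordinate \<open>idxN1\<close>. Both have length 1, so \<open>d \<bullet> e\<close> is minus half
  of \<open>d \<bullet> d\<close>, which turns \<open>v \<bullet> e\<close> into
  \<open>v \<bullet> \<omega>\<close>. Both lie in \<open>piN\<close>, so the difference
  \<open>d\<close> has no \<open>idxN\<close> component and that coordinate stays fixed. The bound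
  on the dimension makes \<open>idxN1\<close> and \<open>idxN\<close> distinct.\<close>

lemma reflection_to_idxN1:
  fixes \<omega> :: "real^('n::{finite,linorder})"
  assumes "CARD('n::{finite,linorder}) \<ge> 2" "\<omega> \<in> piN" "norm \<omega> = 1"
  obtains R :: "real^('n::{finite,linorder}) \<Rightarrow> real^('n::{finite,linorder})" where "orthogonal_transformation R"
    "\<And>v. R v $ idxN = v $ idxN" "\<And>v. R v $ idxN1 = v \<bullet> \<omega>"
proof -
  define e :: "real^('n::{finite,linorder})" where "e = axis idxN1 1"
  define d where "d = \<omega> - e"
  \<comment> \<open>If \<omega> is already \<open>e\<close>, then \<open>d = 0\<close> and this is
    the identity, hence the case splits below.\<close>
  define R where "R v = v - (2 * (v \<bullet> d) / (d \<bullet> d)) *\<^sub>R d" for v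
  have "(UNIV :: 'n set) - {idxN} \<noteq> {}"
  proof
    assume "(UNIV :: 'n set) - {idxN} = {}"
    then have "CARD('n) \<le> card {idxN :: 'n}"
      by (intro card_mono) auto
    with assms(1) show False by simp
  qed
  then have "(idxN1 :: 'n) \<in> UNIV - {idxN}"
    unfolding idxN1_def by (intro Max_in) auto
  then have ne: "(idxN1 :: 'n) \<noteq> idxN" by simp
  have dN: "d $ idxN = 0"
    using assms(2) ne by (simp add: d_def e_def piN_def axis_def)
  have ww: "\<omega> \<bullet> \<omega> = 1" using assms(3) by (simp add: norm_eq_1)
  have ee: "e \<bullet> e = 1" by (simp add: e_def inner_axis_axis)
  have dd: "d \<bullet> d = 2 - 2 * (\<omega> \<bullet> e)" and de: "d \<bullet> e = \<omega> \<bullet> e - 1"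
    by (simp_all add: d_def inner_diff ww ee inner_commute)
  have lin: "linear R"
    unfolding R_def
    by (intro linearI) (simp_all add: algebra_simps inner_add_left add_divide_distrib)
  have nrm: "norm (R v) = norm v" for v
  proof (cases "d = 0")
    case False
    then have "d \<bullet> d \<noteq> 0" by simp
    then have "R v \<bullet> R v = v \<bullet> v"
      by (simp add: R_def inner_diff inner_commute field_simps power2_eq_square)
    then show ?thesis by (simp add: norm_eq)
  qed (simp add: R_def)
  have "R v \<bullet> e = v \<bullet> \<omega>" for v
  proof (cases "d = 0")
    case True
    then show ?thesis by (simp add: R_def d_def)
  next
    case False
    then have "d \<bullet> d \<noteq> 0" by simp
    moreover have "R v \<bullet> e = v \<bullet> e - 2 * (v \<bullet> d) / (d \<bullet> d) * (d \<bullet> e)"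
      by (simp add: R_def inner_diff_left)
    moreover have "d \<bullet> e = - (d \<bullet> d) / 2" by (simp add: dd de)
    ultimately have "R v \<bullet> e = v \<bullet> e + v \<bullet> d" by simp
    then show ?thesis by (simp add: d_def inner_diff_right)
  qed
  then have "R v $ idxN1 = v \<bullet> \<omega>" for v
    by (simp add: e_def inner_axis)
  moreover have "R v $ idxN = v $ idxN" for v
    by (simp add: R_def dN)
  ultimately show thesis
    using that lin nrm by (auto simp: orthogonal_transformation)
qed

section \<open>Cones and their congruent copies\<close>

text \<open>Reduces a cone to data that survive congruence: convexity, an inscribed disc of
  \<open>piN\<close> and a bound on distances. Convexity holds since the conical hull of a convex
  set is convex.\<close>

lemma pi_cone0_props:
  fixes C :: "(real^('n::{finite,linorder})) set"
  assumes "pi_cone0 C"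
  obtains p s D where "0 < s" "0 < D" "C \<subseteq> piN" "convex C" "p \<in> piN" "cball p s \<inter> piN \<subseteq> C"
    "\<And>u v. u \<in> C \<Longrightarrow> v \<in> C \<Longrightarrow> dist u v \<le> D"
proof -
  obtain \<rho> c s where *: "\<rho> > 0" "s > 0" "c \<in> piN" "norm c \<ge> s" and
    C: "C = cball 0 \<rho> \<inter> piN \<inter> {t *\<^sub>R y | t y. t \<ge> 0 \<and> y \<in> cball c s \<inter> piN}"
    using assms unfolding pi_cone0_def by blast
  have "{t *\<^sub>R y | t y. t \<ge> 0 \<and> y \<in> cball c s \<inter> piN} = cone hull (cball c s \<inter> piN)"
    by (simp add: cone_hull_expl)
  moreover have "convex (cone hull (cball c s \<inter> piN))"
    by (intro convex_cone_hull convex_Int convex_cball subspace_imp_convex subspace_piN)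
  ultimately have cv: "convex C"
    unfolding C by (metis convex_Int convex_cball subspace_imp_convex subspace_piN)
  \<comment> \<open>Points of the disc about \<open>c\<close> have norm at most
    \<open>norm c + s\<close>, so scaling by \<tau> brings the disc into
    \<open>cball 0 \<rho>\<close>.\<close>
  define \<tau> where "\<tau> = \<rho> / (norm c + s)"
  have \<tau>: "\<tau> > 0" "\<tau> * (norm c + s) = \<rho>"
    using * by (auto simp: \<tau>_def add_nonneg_pos intro!: divide_pos_pos)
  have "cball (\<tau> *\<^sub>R c) (\<tau> * s) \<inter> piN \<subseteq> C"
  proof
    fix v assume v: "v \<in> cball (\<tau> *\<^sub>R c) (\<tau> * s) \<inter> piN"
    have vc: "norm (v - \<tau> *\<^sub>R c) \<le> \<tau> * s" 
      using v by (simp add: dist_norm norm_minus_commute)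
    have "norm v \<le> norm (\<tau> *\<^sub>R c) + norm (v - \<tau> *\<^sub>R c)"
      by (metis add.commute diff_add_cancel norm_triangle_ineq)
    also have "\<dots> \<le> \<tau> * norm c + \<tau> * s" using vc \<tau> by simp
    also have "\<dots> = \<rho>" using \<tau>(2) by (simp add: algebra_simps)
    finally have "norm v \<le> \<rho>" .
    have "v - \<tau> *\<^sub>R c = \<tau> *\<^sub>R (v /\<^sub>R \<tau> - c)" using \<tau> by (simp add: algebra_simps)
    with vc have "\<tau> * norm (v /\<^sub>R \<tau> - c) \<le> \<tau> * s" using \<tau> by simp
    then have "norm (v /\<^sub>R \<tau> - c) \<le> s" using \<tau> by simp
    then have "v /\<^sub>R \<tau> \<in> cball c s \<inter> piN"
      using v by (simp add: dist_norm norm_minus_commute subspace_scale[OF subspace_piN])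
    moreover have "v = \<tau> *\<^sub>R (v /\<^sub>R \<tau>)" using \<tau> by simp
    ultimately have "v \<in> {t *\<^sub>R y | t y. t \<ge> 0 \<and> y \<in> cball c s \<inter> piN}"
      using \<tau>(1) by (intro CollectI exI[of _ \<tau>] exI[of _ "v /\<^sub>R \<tau>"]) auto
    then show "v \<in> C" using v \<open>norm v \<le> \<rho>\<close> by (simp add: C)
  qed
  moreover have "dist u v \<le> 2 * \<rho>" if "u \<in> C" "v \<in> C" for u v
  proof -
    have "norm u \<le> \<rho>" "norm v \<le> \<rho>" using that by (auto simp: C)
    then show ?thesis using norm_triangle_ineq4[of u v] by (simp add: dist_norm)
  qed
  moreover have "\<tau> *\<^sub>R c \<in> piN" using * by (simp add: subspace_scale[OF subspace_piN])
  moreover have "C \<subseteq> piN" by (auto simp: C)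
  ultimately show thesis
    using that[of "\<tau> * s" "2 * \<rho>" "\<tau> *\<^sub>R c"] cv * \<tau> by auto
qed

text \<open>A congruence is an isometry of the whole space and need not respect \<open>piN\<close> a
  priori. But its inverse carries a disc of \<open>piN\<close> into \<open>A\<close>, hence into
  \<open>piN\<close>, which forces its linear part to preserve \<open>piN\<close>; so the disc goes
  to a disc of \<open>piN\<close>.\<close>

lemma congruent_in_piN:
  fixes C :: "(real^('n::{finite,linorder})) set"
  assumes "C \<subseteq> piN" "convex C" "p \<in> piN" "0 < s" "cball p s \<inter> piN \<subseteq> C"
    and "A \<subseteq> piN" "congruent_sets A C"
  shows "convex A" "\<exists>p'\<in>piN. cball p' s \<inter> piN \<subseteq> A"
proof -
  obtain f where f: "bij f" "\<And>x y. dist (f x) (f y) = dist x y" "f ` A = C"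
    using assms(7) unfolding congruent_sets_def by blast
  define g where "g = inv f"
  have fg: "f (g v) = v" for v
    using f(1) by (simp add: g_def bij_is_surj surj_f_inv_f)
  have gC: "g ` C = A"
    using f by (metis bij_is_inj g_def image_inv_f_f)
  \<comment> \<open>An isometry that fixes 0 is orthogonal, so \<open>T\<close> is the linear part
    of \<open>g\<close>.\<close>
  define T where "T v = g v - g 0" for v
  have orth: "orthogonal_transformation T"
    unfolding orthogonal_transformation_isometry
    using f(2)[of "g _" "g _", symmetric] by (simp add: T_def fg dist_norm)
  then have lin: "linear T" by (rule orthogonal_transformation_linear)
  have g: "g v = g 0 + T v" for v by (simp add: T_def)
  have "A = (+) (g 0) ` T ` C"
    by (simp add: gC[symmetric] T_def image_image)
  then show "convex A"
    using assms(2) lin by (simp add: convex_linear_image)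
  have pC: "p \<in> C" using assms by auto
  then have gp: "g p \<in> piN" using gC assms(6) by blast
  have "T v \<in> piN" if "v \<in> piN" for v
  proof -
    \<comment> \<open>Scaled so that \<open>p + \<epsilon> *\<^sub>R v\<close> stays in the disc,
      where \<open>g\<close> is known to take values in \<open>piN\<close>.\<close>
    define \<epsilon> where "\<epsilon> = s / (norm v + 1)"
    have \<epsilon>: "\<epsilon> > 0" "\<epsilon> * norm v \<le> s"
      using assms(4) by (auto simp: \<epsilon>_def field_simps add_pos_nonneg intro!: divide_pos_pos)
    then have "p + \<epsilon> *\<^sub>R v \<in> cball p s \<inter> piN"
      using that assms(3) by (auto simp: dist_norm subspace_add[OF subspace_piN] subspace_scale[OF subspace_piN])
    then have "g (p + \<epsilon> *\<^sub>R v) \<in> piN" using assms(5,6) gC by blast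
    then have "g (p + \<epsilon> *\<^sub>R v) - g p \<in> piN" using gp by (intro subspace_diff[OF subspace_piN])
    moreover have "g (p + \<epsilon> *\<^sub>R v) - g p = \<epsilon> *\<^sub>R T v"
      by (simp add: g[of "p + _"] g[of p] linear_add[OF lin] linear_scale[OF lin])
    ultimately have "(1 / \<epsilon>) *\<^sub>R (\<epsilon> *\<^sub>R T v) \<in> piN"
      by (metis subspace_scale subspace_piN)
    then show ?thesis using \<epsilon> by simp
  qed
  then have sub: "T ` piN \<subseteq> piN" by blast
  have "inj T" using orth orthogonal_transformation_inj by blast
  \<comment> \<open>Equality of dimensions upgrades the inclusion to surjectivity on
    \<open>piN\<close>, so each point of the disc about \<open>g p\<close> comes from the disc about
    \<open>p\<close>.\<close>
  then have "dim (T ` piN) = dim (piN :: (real^('n::{finite,linorder})) set)"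
    using lin by (simp add: dim_image_eq inj_on_subset)
  then have Teq: "T ` piN = piN"
    using sub subspace_piN lin by (metis linear_subspace_image order_refl subspace_dim_equal)
  have "cball (g p) s \<inter> piN \<subseteq> A"
  proof
    fix w assume w: "w \<in> cball (g p) s \<inter> piN"
    then have "w - g p \<in> piN" using gp by (simp add: subspace_diff[OF subspace_piN])
    then obtain v where v: "v \<in> piN" "w - g p = T v" using Teq by blast
    have "norm v = norm (w - g p)" using v orth by (simp add: orthogonal_transformation)
    then have "p + v \<in> cball p s \<inter> piN"
      using w v assms(3) by (simp add: dist_norm norm_minus_commute subspace_add[OF subspace_piN])
    moreover have "g (p + v) = w"
      using v(2) by (simp add: g[of "p + v"] g[of p] linear_add[OF lin] algebra_simps)
    ultimately show "w \<in> A" using assms(5) gC by blast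
  qed
  then show "\<exists>p'\<in>piN. cball p' s \<inter> piN \<subseteq> A" using gp by blast
qed

section \<open>Flattening the boundary of a star-shaped set\<close>

text \<open>Let \<open>\<omega>\<close> be the direction from \<open>q\<close> to \<open>z0\<close> and \<open>P\<close> the projection orthogonal to it. Near \<open>z0\<close>
  the set \<open>S\<close> is closed under subtracting vectors \<open>\<gamma>\<close> of the cone \<open>\<Lambda> * norm (P \<gamma>) \<le> \<gamma> \<bullet> \<omega>\<close>. So it
  is the sublevel set \<open>w \<bullet> \<omega> + g w \<le> 0\<close>, where \<open>g\<close> is the infimal convolution of \<open>S\<close> with this cone
  and depends, in a Lipschitz way, only on \<open>P w\<close>.\<close>
lemma star_shaped_flatten_boundary:
  fixes S :: "(real^('n::{finite,linorder})) set"
  assumes card: "CARD('n::{finite,linorder}) \<ge> 2" and S: "compact S" "S \<subseteq> piN" and s: "0 < s" and q: "q \<in> piN"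
    and star: "\<And>p b \<mu>. p \<in> S \<Longrightarrow> b \<in> cball q s \<inter> piN \<Longrightarrow> 0 \<le> \<mu> \<Longrightarrow> \<mu> \<le> 1 \<Longrightarrow>
        (1 - \<mu>) *\<^sub>R p + \<mu> *\<^sub>R b \<in> S"
    and z0: "z0 \<in> S" "s \<le> dist z0 q" "dist z0 q \<le> R"
    and bd: "\<And>\<delta>. \<delta> > 0 \<Longrightarrow> \<not> ball z0 \<delta> \<inter> piN \<subseteq> S"
  obtains \<Theta> :: "real^('n::{finite,linorder}) \<Rightarrow> real^('n::{finite,linorder})" where "\<Theta> z0 = 0"
    "\<And>a b. dist (\<Theta> a) (\<Theta> b) \<le> (2 + 2 * R / s) * dist a b"
    "\<And>a b. dist a b \<le> (2 + 2 * R / s) * dist (\<Theta> a) (\<Theta> b)"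
    "\<And>w. w \<in> cball z0 (s/2) \<Longrightarrow> \<Theta> w \<in> piP \<longleftrightarrow> w \<in> S"
proof -
  \<comment> \<open>The slope for which the lateral error below, at most
    \<open>\<mu> * (D / \<Lambda>)\<close> before division by \<mu>, ends up at most
    \<open>s / 2\<close>.\<close>
  define \<Lambda> where "\<Lambda> = 2 * R / s"
  have Rpos: "R > 0" using z0 s by linarith
  have \<Lambda>: "\<Lambda> > 0" using Rpos s by (simp add: \<Lambda>_def)
  define D where "D = dist z0 q"
  have D: "s \<le> D" "D \<le> R" "0 < D" using z0 s by (auto simp: D_def)
  define \<omega> where "\<omega> = (z0 - q) /\<^sub>R D"
  have D\<omega>: "D *\<^sub>R \<omega> = z0 - q" using D by (simp add: \<omega>_def)
  have n\<omega>: "norm \<omega> = 1" using D by (simp add: \<omega>_def D_def dist_norm)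
  then have \<omega>\<omega>: "\<omega> \<bullet> \<omega> = 1" by (simp add: norm_eq_1)
  have z0pi: "z0 \<in> piN" using z0 S by blast
  have \<omega>pi: "\<omega> \<in> piN"
    using z0pi q by (simp add: \<omega>_def subspace_scale[OF subspace_piN] subspace_diff[OF subspace_piN])
  define P where "P v = v - (v \<bullet> \<omega>) *\<^sub>R \<omega>" for v
  have P\<omega>: "P v \<bullet> \<omega> = 0" for v by (simp add: P_def inner_diff_left \<omega>\<omega>)
  have Pdiff: "P (a - b) = P a - P b" for a b by (simp add: P_def algebra_simps inner_diff_left)
  have Psplit: "v = P v + (v \<bullet> \<omega>) *\<^sub>R \<omega>" for v by (simp add: P_def)
  have Pyth: "(norm v)\<^sup>2 = (norm (P v))\<^sup>2 + (v \<bullet> \<omega>)\<^sup>2" for v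
    unfolding power2_norm_eq_inner P_def inner_diff_left inner_diff_right inner_scaleR_left
      inner_scaleR_right \<omega>\<omega>
    by (simp add: inner_commute power2_eq_square algebra_simps)
  have Pnorm: "norm (P v) \<le> norm v" for v
    by (rule power2_le_imp_le) (use Pyth[of v] in auto)
  have inn: "\<bar>v \<bullet> \<omega>\<bar> \<le> norm v" for v
    using Cauchy_Schwarz_ineq2[of v \<omega>] n\<omega> by simp
  define T where "T = S \<inter> cball z0 (s/2)"
  have T: "compact T" "z0 \<in> T" using S z0 s by (auto simp: T_def intro!: compact_Int_closed)
  \<comment> \<open>\<open>w \<bullet> \<omega> + G w p \<le> 0\<close> says exactly that
    \<open>p - w\<close> lies in the cone of slope \<Lambda>. Minimising over the compact
    \<open>T\<close> therefore asks whether some point of \<open>T\<close> has \<open>w\<close> in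
    its downward cone.\<close>
  define G where "G w p = \<Lambda> * norm (P (w - p)) - p \<bullet> \<omega>" for w p
  have contG: "continuous_on T (G w)" for w
    unfolding G_def P_def by (intro continuous_intros)
  have "\<exists>p\<in>T. \<forall>p'\<in>T. G w p \<le> G w p'" for w
    using continuous_attains_inf[OF T(1) _ contG] T(2) by blast
  then obtain m where m: "\<And>w. m w \<in> T" "\<And>w p'. p' \<in> T \<Longrightarrow> G w (m w) \<le> G w p'"
    by metis
  define g where "g w = G w (m w)" for w
  have gle: "g a - g b \<le> \<Lambda> * norm (P (a - b))" for a b
  proof -
    have "g a \<le> G a (m b)" unfolding g_def using m by blast
    moreover have "G a (m b) - G b (m b) \<le> \<Lambda> * norm (P (a - b))"
    proof -
      have "norm (P (a - m b)) \<le> norm (P (a - b)) + norm (P (b - m b))"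
        using norm_triangle_ineq[of "P (a - b)" "P (b - m b)"] by (simp add: Pdiff)
      then have "\<Lambda> * norm (P (a - m b)) \<le> \<Lambda> * (norm (P (a - b)) + norm (P (b - m b)))"
        using \<Lambda> by simp
      then show ?thesis by (simp add: G_def algebra_simps)
    qed
    ultimately show ?thesis by (simp add: g_def)
  qed
  have Pminus: "norm (P (a - b)) = norm (P (b - a))" for a b
    by (simp add: Pdiff norm_minus_commute)
  have glip: "\<bar>g a - g b\<bar> \<le> \<Lambda> * norm (P (a - b))" for a b
    using gle[of a b] gle[of b a] Pminus[of a b] by (simp add: abs_le_iff)
  define h where "h w = w \<bullet> \<omega> + g w" for w
  have hS: "h w \<le> 0 \<longleftrightarrow> w \<in> S" if w: "w \<in> cball z0 (s/2)" "w \<in> piN" for w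
  proof
    assume "w \<in> S"
    then have "w \<in> T" using w by (simp add: T_def)
    then have "g w \<le> G w w" using m by (simp add: g_def)
    then show "h w \<le> 0" by (simp add: h_def G_def P_def)
  next
    assume "h w \<le> 0"
    define p where "p = m w"
    have p: "p \<in> S" "p \<in> cball z0 (s/2)" using m(1)[of w] by (auto simp: p_def T_def)
    define \<gamma> where "\<gamma> = p - w"
    have "\<Lambda> * norm (P (w - p)) \<le> (p - w) \<bullet> \<omega>"
      using \<open>h w \<le> 0\<close> by (simp add: h_def g_def p_def[symmetric] G_def inner_diff_left)
    then have cone: "\<Lambda> * norm (P \<gamma>) \<le> \<gamma> \<bullet> \<omega>" by (simp add: \<gamma>_def Pminus)
    show "w \<in> S"
    proof (cases "\<gamma> \<bullet> \<omega> = 0")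
      case True
      have "\<Lambda> * norm (P \<gamma>) \<ge> 0" using \<Lambda> by simp
      with cone True have "\<Lambda> * norm (P \<gamma>) = 0" by linarith
      with \<Lambda> have "P \<gamma> = 0" by simp
      with Psplit[of \<gamma>] True have "\<gamma> = 0" by simp
      then show ?thesis using p by (simp add: \<gamma>_def)
    next
      case False
      have "\<Lambda> * norm (P \<gamma>) \<ge> 0" using \<Lambda> by simp
      with cone False have pos: "\<gamma> \<bullet> \<omega> > 0" by linarith
      \<comment> \<open>With this \<mu> the vector \<open>\<gamma> /\<^sub>R \<mu>\<close> has
        \<omega>-component \<open>D\<close>, the distance from \<open>z0\<close> to
        \<open>q\<close>. Hence \<open>b\<close> differs from \<open>q\<close> only by
        \<open>p - z0\<close> and the lateral part of \<open>\<gamma> /\<^sub>R \<mu>\<close>, each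
        of norm at most \<open>s / 2\<close>, and \<open>w\<close> lies on the segment from
        \<open>p\<close> to a point of the disc.\<close>
      define \<mu> where "\<mu> = (\<gamma> \<bullet> \<omega>) / D"
      have "norm \<gamma> \<le> s"
        using p(2) w(1) dist_triangle2[of p w z0] by (simp add: \<gamma>_def dist_norm norm_minus_commute)
      then have "\<gamma> \<bullet> \<omega> \<le> D" using inn[of \<gamma>] D by linarith
      then have \<mu>: "0 < \<mu>" "\<mu> \<le> 1" using pos D by (auto simp: \<mu>_def)
      define b where "b = p - \<gamma> /\<^sub>R \<mu>"
      have w_eq: "w = (1 - \<mu>) *\<^sub>R p + \<mu> *\<^sub>R b"
        using \<mu> by (simp add: b_def \<gamma>_def algebra_simps)
      have bpi: "b \<in> piN"
        unfolding b_def \<gamma>_def using p(1) S(2) w(2)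
        by (intro subspace_diff subspace_scale subspace_piN) auto
      have \<mu>D: "inverse \<mu> * (\<gamma> \<bullet> \<omega>) = D" using pos D by (simp add: \<mu>_def)
      have "\<gamma> /\<^sub>R \<mu> = P \<gamma> /\<^sub>R \<mu> + D *\<^sub>R \<omega>"
        using \<mu>D by (simp add: P_def algebra_simps)
      then have "b - q = (p - z0) - P \<gamma> /\<^sub>R \<mu>"
        by (simp add: b_def D\<omega>)
      then have "norm (b - q) \<le> norm (p - z0) + norm (P \<gamma> /\<^sub>R \<mu>)"
        by (metis norm_triangle_ineq4)
      also have "norm (P \<gamma> /\<^sub>R \<mu>) = norm (P \<gamma>) / \<mu>"
        using \<mu> by (simp add: divide_inverse mult.commute)
      also have "norm (P \<gamma>) / \<mu> \<le> s / 2"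
      proof -
        have "norm (P \<gamma>) \<le> (\<gamma> \<bullet> \<omega>) / \<Lambda>" using cone \<Lambda> by (simp add: field_simps)
        also have "\<dots> = \<mu> * (D / \<Lambda>)" using D by (simp add: \<mu>_def)
        also have "\<dots> \<le> \<mu> * (R / \<Lambda>)"
          using D \<Lambda> \<mu> by (intro mult_left_mono divide_right_mono) auto
        also have "R / \<Lambda> = s / 2" using Rpos s by (simp add: \<Lambda>_def)
        finally show ?thesis using \<mu> by (simp add: field_simps)
      qed
      also have "norm (p - z0) \<le> s / 2" using p(2) by (simp add: dist_norm norm_minus_commute)
      finally have "b \<in> cball q s" by (simp add: dist_norm norm_minus_commute)
      then show ?thesis
        unfolding w_eq using star[OF p(1)] bpi \<mu> by auto
    qed
  qed
  \<comment> \<open>If \<open>h z0 < 0\<close>, the Lipschitz constant \<open>1 + \<Lambda>\<close>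
    of \<open>h\<close> would put a relative neighbourhood of \<open>z0\<close> into
    \<open>S\<close>, against \<open>bd\<close>. So subtracting \<open>E z0\<close> later does not
    move the zero level of \<open>h\<close>.\<close>
  have hz0: "h z0 = 0"
  proof (rule ccontr)
    assume "h z0 \<noteq> 0"
    moreover have "h z0 \<le> 0" using hS[of z0] z0 z0pi s by simp
    ultimately have neg: "h z0 < 0" by simp
    define \<delta> where "\<delta> = min (s/2) (- h z0 / (1 + \<Lambda>))"
    have \<delta>: "\<delta> > 0" using neg \<Lambda> s by (simp add: \<delta>_def divide_neg_pos)
    have "ball z0 \<delta> \<inter> piN \<subseteq> S"
    proof
      fix w assume w: "w \<in> ball z0 \<delta> \<inter> piN"
      then have d: "norm (w - z0) < \<delta>" by (simp add: dist_norm norm_minus_commute)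
      have "h w - h z0 = (w - z0) \<bullet> \<omega> + (g w - g z0)" by (simp add: h_def inner_diff_left)
      also have "\<dots> \<le> norm (w - z0) + \<Lambda> * norm (w - z0)"
        using inn[of "w - z0"] gle[of w z0] mult_left_mono[OF Pnorm[of "w - z0"], of \<Lambda>] \<Lambda> by linarith
      also have "\<dots> = (1 + \<Lambda>) * norm (w - z0)" by (simp add: algebra_simps)
      also have "\<dots> \<le> (1 + \<Lambda>) * (- h z0 / (1 + \<Lambda>))"
        using d \<Lambda> by (intro mult_left_mono) (auto simp: \<delta>_def)
      also have "\<dots> = - h z0" using \<Lambda> by simp
      finally have "h w \<le> 0" by simp
      then show "w \<in> S" using hS[of w] w by (auto simp: \<delta>_def)
    qed
    with bd[OF \<delta>] show False by simp
  qed
  \<comment> \<open>A shear with the \<omega> axis reversed: the part orthogonal to \<omega> is kept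
    and the \<omega>-coordinate becomes \<open>- h w\<close>, so that \<open>S\<close> lands on the
    nonnegative side as in \<open>piP\<close>.\<close>
  define E where "E w = P w - h w *\<^sub>R \<omega>" for w
  have E\<omega>: "(E a - E b) \<bullet> \<omega> = h b - h a" for a b
    by (simp add: E_def inner_diff_left P\<omega> \<omega>\<omega>)
  have Ediff: "E a - E b = P (a - b) - (h a - h b) *\<^sub>R \<omega>" for a b
    by (simp add: E_def Pdiff algebra_simps)
  have PE: "P (E a - E b) = P (a - b)" for a b
  proof -
    have "P (E a - E b) = (E a - E b) - (h b - h a) *\<^sub>R \<omega>" by (simp only: P_def E\<omega>)
    also have "\<dots> = P (a - b)" unfolding Ediff by (simp add: algebra_simps)
    finally show ?thesis .
  qed
  have up: "norm (E a - E b) \<le> (2 + \<Lambda>) * norm (a - b)" for a b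
  proof -
    have "norm (E a - E b) \<le> norm (P (a - b)) + \<bar>h a - h b\<bar>"
      unfolding Ediff using norm_triangle_ineq4[of "P (a - b)" "(h a - h b) *\<^sub>R \<omega>"] n\<omega> by simp
    also have "\<bar>h a - h b\<bar> \<le> \<bar>(a - b) \<bullet> \<omega>\<bar> + \<bar>g a - g b\<bar>"
      by (simp add: h_def inner_diff_left)
    also have "\<dots> \<le> norm (a - b) + \<Lambda> * norm (a - b)"
      using inn[of "a - b"] glip[of a b] mult_left_mono[OF Pnorm[of "a - b"], of \<Lambda>] \<Lambda> by linarith
    also have "norm (P (a - b)) \<le> norm (a - b)" by (rule Pnorm)
    finally show ?thesis by (simp add: algebra_simps)
  qed
  \<comment> \<open>\<open>g\<close> varies only with the projection, which \<open>E\<close>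
    preserves; so the \<omega>-component of \<open>a - b\<close> is recovered from
    \<open>h a - h b\<close> up to an error of at most
    \<open>\<Lambda> * norm (E a - E b)\<close>.\<close>
  have lo: "norm (a - b) \<le> (2 + \<Lambda>) * norm (E a - E b)" for a b
  proof -
    have PP: "norm (P (a - b)) \<le> norm (E a - E b)"
      using Pnorm[of "E a - E b"] by (simp add: PE)
    have "\<bar>h a - h b\<bar> \<le> norm (E a - E b)" using inn[of "E a - E b"] E\<omega>[of a b] by linarith
    moreover have "\<bar>(a - b) \<bullet> \<omega>\<bar> \<le> \<bar>h a - h b\<bar> + \<bar>g a - g b\<bar>"
      by (simp add: h_def inner_diff_left)
    moreover have "\<bar>g a - g b\<bar> \<le> \<Lambda> * norm (E a - E b)"
      using glip[of a b] mult_left_mono[OF PP, of \<Lambda>] \<Lambda> by linarith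
    moreover have "norm (a - b) \<le> norm (P (a - b)) + \<bar>(a - b) \<bullet> \<omega>\<bar>"
      using norm_triangle_ineq[of "P (a - b)" "((a - b) \<bullet> \<omega>) *\<^sub>R \<omega>"] Psplit[of "a - b"] n\<omega> by simp
    ultimately have "norm (a - b) \<le> 2 * norm (E a - E b) + \<Lambda> * norm (E a - E b)"
      using PP by linarith
    then show ?thesis by (simp add: algebra_simps)
  qed
  obtain U :: "real^('n::{finite,linorder}) \<Rightarrow> real^('n::{finite,linorder})" where U: "orthogonal_transformation U"
    "\<And>v. U v $ idxN = v $ idxN" "\<And>v. U v $ idxN1 = v \<bullet> \<omega>"
    using reflection_to_idxN1[OF card \<omega>pi n\<omega>] by blast
  have Udist: "dist (U a) (U b) = dist a b" for a b
    using U(1) orthogonal_transformation_isometry by blast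
  define \<Theta> where "\<Theta> w = U (E w - E z0)" for w
  have "\<Theta> z0 = 0"
    using U(1) by (simp add: \<Theta>_def orthogonal_transformation_linear linear_0)
  moreover have "dist (\<Theta> a) (\<Theta> b) = norm (E a - E b)" for a b
    unfolding \<Theta>_def Udist by (simp add: dist_norm)
  moreover have "\<Theta> w \<in> piP \<longleftrightarrow> w \<in> S" if w: "w \<in> cball z0 (s/2)" for w
  proof -
    have "\<Theta> w $ idxN = w $ idxN"
      using \<omega>pi z0pi by (simp add: \<Theta>_def U(2) E_def P_def piN_def)
    moreover have "\<Theta> w $ idxN1 = - h w"
      using E\<omega>[of w z0] by (simp add: \<Theta>_def U(3) hz0)
    ultimately have "\<Theta> w \<in> piP \<longleftrightarrow> w \<in> piN \<and> h w \<le> 0"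
      by (simp add: piP_def piN_def)
    then show ?thesis using hS[OF w] S(2) by blast
  qed
  ultimately show thesis
    using that[of \<Theta>] up lo by (simp add: dist_norm \<Lambda>_def)
qed

section \<open>Star-shaped parts of a closed set\<close>

text \<open>For nonempty convex \<open>B\<close> this is the largest subset of \<open>Q\<close> that
  is star-shaped with respect to every point of \<open>B\<close>.\<close>

definition seen_from :: "'a::real_vector set \<Rightarrow> 'a set \<Rightarrow> 'a set" where
  "seen_from B Q = {p. \<forall>b\<in>B. closed_segment p b \<subseteq> Q}"

text \<open>A point between \<open>p'\<close> and \<open>b'\<close> is a convex combination of
  \<open>p\<close>, \<open>b\<close> and \<open>b'\<close>. Merging the last two into one point
  \<open>c\<close> of the convex set \<open>B\<close> places it on a segment from \<open>p\<close>
  to \<open>B\<close>.\<close>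

lemma seen_from_segment:
  assumes "convex B" "p \<in> seen_from B Q" "b \<in> B"
  shows "closed_segment p b \<subseteq> seen_from B Q"
proof
  fix p' assume "p' \<in> closed_segment p b"
  then obtain u where u: "0 \<le> u" "u \<le> 1" "p' = (1 - u) *\<^sub>R p + u *\<^sub>R b"
    by (auto simp: in_segment)
  show "p' \<in> seen_from B Q"
    unfolding seen_from_def
  proof (intro CollectI ballI subsetI)
    fix b' y assume b': "b' \<in> B" and "y \<in> closed_segment p' b'"
    then obtain v where v: "0 \<le> v" "v \<le> 1" "y = (1 - v) *\<^sub>R p' + v *\<^sub>R b'"
      by (auto simp: in_segment)
    \<comment> \<open>The joint weight of \<open>b\<close> and \<open>b'\<close> in
      \<open>y\<close>; if it vanishes, there is nothing to merge and \<open>y = p\<close>.\<close>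
    define w where "w = (1 - v) * u + v"
    have w: "1 - w = (1 - v) * (1 - u)" by (simp add: w_def algebra_simps)
    have w01: "0 \<le> w" "w \<le> 1"
      using u v by (simp add: w_def, metis w diff_ge_0_iff_ge mult_nonneg_nonneg)
    show "y \<in> Q"
    proof (cases "w = 0")
      case True
      have "0 \<le> (1 - v) * u" using u v by simp
      with True v have "v = 0" by (simp add: w_def)
      with True have "u = 0" by (simp add: w_def)
      with \<open>v = 0\<close> u v have "y = p" by simp
      then show ?thesis using assms(2,3) by (auto simp: seen_from_def)
    next
      case False
      define c where "c = ((1 - v) * u / w) *\<^sub>R b + (v / w) *\<^sub>R b'"
      have "(1 - v) * u / w + v / w = 1"
        using False by (simp add: w_def add_divide_distrib[symmetric])
      then have "c \<in> B"
        unfolding c_def using u v w01 assms(1,3) b' by (intro convexD) auto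
      moreover have "w *\<^sub>R c = ((1 - v) * u) *\<^sub>R b + v *\<^sub>R b'"
        using False by (simp add: c_def scaleR_add_right)
      then have "y = (1 - w) *\<^sub>R p + w *\<^sub>R c"
        unfolding v(3) u(3) w by (simp add: algebra_simps)
      ultimately show ?thesis
        using assms(2) w01 by (force simp: seen_from_def in_segment)
    qed
  qed
qed

lemma seen_from_subset: "B \<noteq> {} \<Longrightarrow> seen_from B Q \<subseteq> Q"
  by (auto simp: seen_from_def)

lemma closed_seen_from:
  fixes Q :: "'a::real_normed_vector set"
  assumes "closed Q"
  shows "closed (seen_from B Q)"
proof -
  have "seen_from B Q = (\<Inter>b\<in>B. \<Inter>u\<in>{0..1}. (\<lambda>p. (1 - u) *\<^sub>R p + u *\<^sub>R b) -` Q)"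
    by (fastforce simp: seen_from_def closed_segment_def)
  also have "closed \<dots>"
    by (intro closed_INT ballI closed_vimage assms continuous_intros)
  finally show ?thesis .
qed

section \<open>Charts for the preimage of a star-shaped set\<close>

text \<open>Where \<phi> sends \<open>z\<close> to a relative interior point of the star-shaped
  image of \<open>H\<close>, a translate of \<phi> is a chart at \<open>z\<close>; elsewhere \<phi>
  is followed by the flattening map. \<open>r' \<le> r / 8\<close> keeps \<open>cball z r'\<close>
  inside \<open>cball x r\<close>, and \<open>L * r' \<le> s / 2\<close> keeps its image where the
  flattening is valid.\<close>

lemma pullback_of_star_shaped_in_classMR:
  fixes \<phi> :: "real^('n::{finite,linorder}) \<Rightarrow> real^('n::{finite,linorder})"
  assumes card: "CARD('n::{finite,linorder}) \<ge> 2" and rL: "0 < r" "0 < L"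
    and K: "compact K" "K \<subseteq> closure \<Omega>"
    and lo: "\<And>a b. a \<in> cball x r \<Longrightarrow> b \<in> cball x r \<Longrightarrow> dist a b \<le> L * dist (\<phi> a) (\<phi> b)"
    and up: "\<And>a b. a \<in> cball x r \<Longrightarrow> b \<in> cball x r \<Longrightarrow> dist (\<phi> a) (\<phi> b) \<le> L * dist a b"
    and \<phi>0: "\<phi> x = 0" and \<phi>pi: "\<phi> ` (K \<inter> ball x r) \<subseteq> piN"
    and q: "q \<in> piN" "norm q \<le> R1" and s: "0 < s"
    and r': "0 < r'" "r' \<le> r / 8" "L * r' \<le> s / 2"
    and H: "H = {z \<in> K \<inter> cball x (3*r/4).
        \<phi> z \<in> seen_from (cball q s \<inter> piN) (\<phi> ` (K \<inter> cball x (3*r/4)))}"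
    and ne: "H \<noteq> {}"
  shows "classMR \<Omega> r' (L * (2 + 2 * (L * r + R1) / s)) H"
proof -
  define B where "B = cball q s \<inter> (piN :: (real^('n::{finite,linorder})) set)"
  define Q where "Q = \<phi> ` (K \<inter> cball x (3*r/4))"
  define S where "S = seen_from B Q"
  \<comment> \<open>The constant of the flattening map, with \<open>L * r + R1\<close> as the bound
    on the distance from \<open>\<phi> z\<close> to \<open>q\<close>.\<close>
  define A where "A = 2 + 2 * (L * r + R1) / s"
  have H': "H = {z \<in> K \<inter> cball x (3*r/4). \<phi> z \<in> S}" by (simp add: H B_def Q_def S_def)
  have "R1 \<ge> 0" using q(2) norm_ge_zero order_trans by blast
  then have A: "A \<ge> 2" "A > 0" using rL s by (auto simp: A_def add_pos_nonneg)
  have sub: "cball x (3*r/4) \<subseteq> ball x r" "cball x (3*r/4) \<subseteq> cball x r" using rL by auto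
  have "continuous_on (cball x r) \<phi>"
    using up rL by (intro lipschitz_on_continuous_on[of L] lipschitz_onI) auto
  then have cont: "continuous_on (K \<inter> cball x (3*r/4)) \<phi>"
    by (rule continuous_on_subset) (use sub in auto)
  have cK: "compact (K \<inter> cball x (3*r/4))" using K by (simp add: compact_Int_closed)
  then have cQ: "compact Q" unfolding Q_def using cont by (intro compact_continuous_image)
  have Qpi: "Q \<subseteq> piN" unfolding Q_def using \<phi>pi sub by blast
  have qB: "q \<in> B" using q s by (simp add: B_def)
  have cvB: "convex B"
    unfolding B_def by (intro convex_Int convex_cball subspace_imp_convex subspace_piN)
  have SQ: "S \<subseteq> Q" unfolding S_def using qB by (intro seen_from_subset) auto
  have clS: "closed S" unfolding S_def using cQ by (intro closed_seen_from compact_imp_closed)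
  then have cS: "compact S" using SQ cQ by (metis compact_Int_closed inf.absorb_iff2)
  have SH: "S = \<phi> ` H" using SQ by (auto simp: H' Q_def)
  have "H = (K \<inter> cball x (3*r/4)) \<inter> \<phi> -` S" by (auto simp: H')
  moreover have "closed ((K \<inter> cball x (3*r/4)) \<inter> \<phi> -` S)"
    by (rule continuous_closed_preimage[OF cont compact_imp_closed[OF cK] clS])
  ultimately have cH: "compact H"
    using cK by (metis compact_Int_closed inf.idem inf.assoc)
  \<comment> \<open>\<open>S\<close> has a point because \<open>H\<close> does, and the segments
    from it to the points of \<open>B\<close> stay in \<open>S\<close>.\<close>
  have BS: "B \<subseteq> S"
    using seen_from_segment[OF cvB, of _ Q] ne SH unfolding S_def
    by (metis ends_in_segment(2) ex_in_conv image_is_empty subset_iff)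
  \<comment> \<open>Whether \<open>z\<close> counts as a boundary point depends on the chart, so
    both alternatives are stated for the same \<psi>; on \<open>bdry\<close> only the flat one
    remains.\<close>
  have "\<exists>\<psi> :: real^('n::{finite,linorder}) \<Rightarrow> real^('n::{finite,linorder}). (\<forall>a\<in>cball z r'. \<forall>b\<in>cball z r'.
                 dist a b / (L * A) \<le> dist (\<psi> a) (\<psi> b) \<and> dist (\<psi> a) (\<psi> b) \<le> (L * A) * dist a b) \<and>
             \<psi> z = 0 \<and> \<psi> ` (H \<inter> ball z r') \<subseteq> piN \<and>
             ((\<exists>\<delta>>0. ball 0 \<delta> \<inter> piN \<subseteq> \<psi> ` (H \<inter> ball z r')) \<or>
              \<psi> ` (H \<inter> ball z r') = \<psi> ` (ball z r') \<inter> piP)" if z: "z \<in> H" for z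
  proof -
    have zS: "\<phi> z \<in> S" and zx: "z \<in> cball x (3*r/4)" using z by (auto simp: H')
    have in_x: "w \<in> cball x r" if "w \<in> cball z r'" for w
      using that zx r' rL dist_triangle[of x w z] by auto
    have zin: "z \<in> cball z r'" using r' by simp
    show ?thesis
    proof (cases "\<exists>\<delta>>0. ball (\<phi> z) \<delta> \<inter> piN \<subseteq> S")
      case True
      then obtain \<delta> where \<delta>: "\<delta> > 0" "ball (\<phi> z) \<delta> \<inter> piN \<subseteq> S" by blast
      define \<psi> where "\<psi> w = \<phi> w - \<phi> z" for w
      have d: "dist (\<psi> a) (\<psi> b) = dist (\<phi> a) (\<phi> b)" for a b by (simp add: \<psi>_def dist_norm)
      have zpi: "\<phi> z \<in> piN" using zS SQ Qpi by blast
      have bilip: "\<forall>a\<in>cball z r'. \<forall>b\<in>cball z r'. dist a b / (L * A) \<le> dist (\<psi> a) (\<psi> b) \<and>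
          dist (\<psi> a) (\<psi> b) \<le> (L * A) * dist a b"
      proof (intro ballI)
        fix a b assume that: "a \<in> cball z r'" "b \<in> cball z r'"
        have "dist a b \<le> L * dist (\<phi> a) (\<phi> b)" "dist (\<phi> a) (\<phi> b) \<le> L * dist a b"
          using lo up in_x that by auto
        moreover have "L * t \<le> L * A * t" if "t \<ge> 0" for t
          using that rL A by (simp add: mult_le_cancel_right)
        ultimately have "dist a b \<le> L * A * dist (\<phi> a) (\<phi> b)" "dist (\<phi> a) (\<phi> b) \<le> L * A * dist a b"
          by (meson order_trans zero_le_dist)+
        then show "dist a b / (L * A) \<le> dist (\<psi> a) (\<psi> b) \<and> dist (\<psi> a) (\<psi> b) \<le> L * A * dist a b"
          using rL A by (simp add: d pos_divide_le_eq mult.commute)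
      qed
      have pi: "\<psi> ` (H \<inter> ball z r') \<subseteq> piN"
        using SH SQ Qpi zpi by (auto simp: \<psi>_def intro!: subspace_diff[OF subspace_piN])
      \<comment> \<open>\<delta> keeps the point in \<open>S\<close>, and \<open>r' / L\<close>
        keeps its preimage in \<open>ball z r'\<close> by the lower Lipschitz bound.\<close>
      have "ball 0 (min \<delta> (r' / L)) \<inter> piN \<subseteq> \<psi> ` (H \<inter> ball z r')"
      proof
        fix v :: "real^('n::{finite,linorder})" assume v: "v \<in> ball 0 (min \<delta> (r' / L)) \<inter> piN"
        then have "\<phi> z + v \<in> ball (\<phi> z) \<delta> \<inter> piN"
          using zpi by (simp add: dist_norm subspace_add[OF subspace_piN])
        then obtain w where w: "w \<in> H" "\<phi> z + v = \<phi> w" using \<delta> SH by blast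
        have "dist z w \<le> L * dist (\<phi> z) (\<phi> w)"
          using w(1) zx sub by (intro lo) (auto simp: H')
        also have "dist (\<phi> z) (\<phi> w) = norm v" using w(2)[symmetric] by (simp add: dist_norm)
        also have "L * norm v < r'" using v rL by (simp add: pos_less_divide_eq mult.commute)
        finally show "v \<in> \<psi> ` (H \<inter> ball z r')"
          using w by (intro image_eqI[of _ _ w]) (auto simp: \<psi>_def algebra_simps)
      qed
      moreover have "min \<delta> (r' / L) > 0" using \<delta> r' rL by simp
      ultimately have int: "\<exists>\<delta>>0. ball 0 \<delta> \<inter> piN \<subseteq> \<psi> ` (H \<inter> ball z r')" by blast
      have "\<psi> z = 0" by (simp add: \<psi>_def)
      show ?thesis
        by (intro exI[of _ \<psi>] conjI disjI1) fact+
    next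
      case False
      \<comment> \<open>\<open>S\<close> contains the whole disc \<open>B\<close>, so a point
        without a relative neighbourhood in \<open>S\<close> cannot be in its open part.\<close>
      have zq1: "s \<le> dist (\<phi> z) q"
      proof (rule ccontr)
        assume "\<not> s \<le> dist (\<phi> z) q"
        moreover have "ball (\<phi> z) (s - dist (\<phi> z) q) \<inter> piN \<subseteq> S"
        proof (intro subset_trans[OF _ BS] subsetI)
          fix w assume w: "w \<in> ball (\<phi> z) (s - dist (\<phi> z) q) \<inter> piN"
          then show "w \<in> B"
            using dist_triangle[of q w "\<phi> z"] by (auto simp: B_def dist_commute)
        qed
        ultimately show False using False by force
      qed
      have zq2: "dist (\<phi> z) q \<le> L * r + R1"
      proof -
        have "norm (\<phi> z) = dist (\<phi> z) (\<phi> x)" using \<phi>0 by simp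
        also have "\<dots> \<le> L * dist z x" using zx sub rL by (intro up) auto
        also have "\<dots> \<le> L * r" using zx rL by (simp add: dist_commute)
        finally show ?thesis using q(2) norm_triangle_ineq4[of "\<phi> z" q] by (simp add: dist_norm)
      qed
      have Spi: "S \<subseteq> piN" using SQ Qpi by blast
      have star: "(1 - \<mu>) *\<^sub>R p + \<mu> *\<^sub>R b \<in> S"
        if "p \<in> S" "b \<in> cball q s \<inter> piN" "0 \<le> \<mu>" "\<mu> \<le> 1" for p b \<mu>
      proof -
        have "closed_segment p b \<subseteq> S"
          using seen_from_segment[OF cvB] that unfolding S_def B_def by blast
        moreover have "(1 - \<mu>) *\<^sub>R p + \<mu> *\<^sub>R b \<in> closed_segment p b"
          using that by (auto simp: in_segment)
        ultimately show ?thesis by blast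
      qed
      have bd: "\<not> ball (\<phi> z) \<delta> \<inter> piN \<subseteq> S" if "\<delta> > 0" for \<delta> using False that by blast
      obtain \<Theta> :: "real^('n::{finite,linorder}) \<Rightarrow> real^('n::{finite,linorder})" where \<Theta>0: "\<Theta> (\<phi> z) = 0"
        and \<Theta>up: "\<And>a b. dist (\<Theta> a) (\<Theta> b) \<le> A * dist a b"
        and \<Theta>lo: "\<And>a b. dist a b \<le> A * dist (\<Theta> a) (\<Theta> b)"
        and \<Theta>P: "\<And>w. w \<in> cball (\<phi> z) (s/2) \<Longrightarrow> \<Theta> w \<in> piP \<longleftrightarrow> w \<in> S"
        by (rule star_shaped_flatten_boundary[OF card cS Spi s q(1) star zS zq1 zq2 bd, folded A_def])
          (assumption | rule that)+
      define \<psi> where "\<psi> w = \<Theta> (\<phi> w)" for w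
      have bilip: "\<forall>a\<in>cball z r'. \<forall>b\<in>cball z r'. dist a b / (L * A) \<le> dist (\<psi> a) (\<psi> b) \<and>
          dist (\<psi> a) (\<psi> b) \<le> (L * A) * dist a b"
      proof (intro ballI conjI)
        fix a b assume that: "a \<in> cball z r'" "b \<in> cball z r'"
        have "dist (\<psi> a) (\<psi> b) \<le> A * dist (\<phi> a) (\<phi> b)" by (simp add: \<psi>_def \<Theta>up)
        also have "\<dots> \<le> A * (L * dist a b)" using up in_x that A by (intro mult_left_mono) auto
        finally show "dist (\<psi> a) (\<psi> b) \<le> (L * A) * dist a b" by (simp add: algebra_simps)
        have "dist a b \<le> L * dist (\<phi> a) (\<phi> b)" using lo in_x that by auto
        also have "\<dots> \<le> L * (A * dist (\<psi> a) (\<psi> b))"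
          using rL \<Theta>lo by (intro mult_left_mono) (auto simp: \<psi>_def)
        finally show "dist a b / (L * A) \<le> dist (\<psi> a) (\<psi> b)"
          using rL A by (simp add: pos_divide_le_eq algebra_simps)
      qed
      have P: "\<psi> w \<in> piP \<longleftrightarrow> w \<in> H" if w: "w \<in> ball z r'" for w
      proof -
        have wx: "w \<in> cball x r" using in_x w by simp
        have "dist (\<phi> z) (\<phi> w) \<le> L * dist z w" using in_x zin wx by (intro up) auto
        also have "\<dots> \<le> L * r'" using w rL by simp
        finally have "\<phi> w \<in> cball (\<phi> z) (s/2)" using r' by simp
        then have "\<psi> w \<in> piP \<longleftrightarrow> \<phi> w \<in> S" by (simp add: \<psi>_def \<Theta>P)
        also have "\<dots> \<longleftrightarrow> w \<in> H"
        proof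
          assume "\<phi> w \<in> S"
          then obtain w' where w': "w' \<in> H" "\<phi> w = \<phi> w'" using SH by blast
          \<comment> \<open>Membership of the image in \<open>S\<close> only yields some
            \<open>w'\<close> in \<open>H\<close> with the same image; injectivity of \<phi>
            identifies it with \<open>w\<close>.\<close>
          then have "dist w w' \<le> L * dist (\<phi> w) (\<phi> w')"
            using wx sub by (intro lo) (auto simp: H')
          then show "w \<in> H" using w' by simp
        qed (use SH in auto)
        finally show ?thesis .
      qed
      have img: "\<psi> ` (H \<inter> ball z r') = \<psi> ` (ball z r') \<inter> piP" using P by blast
      then have pi: "\<psi> ` (H \<inter> ball z r') \<subseteq> piN" by (auto simp: piP_def)
      have "\<psi> z = 0" using \<Theta>0 by (simp add: \<psi>_def)
      show ?thesis
        by (intro exI[of _ \<psi>] conjI disjI2) fact+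
    qed
  qed
  from bchoice[OF ballI[OF this]] obtain \<Psi> :: "real^('n::{finite,linorder}) \<Rightarrow> real^('n::{finite,linorder}) \<Rightarrow> real^('n::{finite,linorder})" where \<Psi>: "\<forall>z\<in>H. (\<forall>a\<in>cball z r'. \<forall>b\<in>cball z r'.
                 dist a b / (L * A) \<le> dist (\<Psi> z a) (\<Psi> z b) \<and> dist (\<Psi> z a) (\<Psi> z b) \<le> (L * A) * dist a b) \<and>
             \<Psi> z z = 0 \<and> \<Psi> z ` (H \<inter> ball z r') \<subseteq> piN \<and>
             ((\<exists>\<delta>>0. ball 0 \<delta> \<inter> piN \<subseteq> \<Psi> z ` (H \<inter> ball z r')) \<or>
              \<Psi> z ` (H \<inter> ball z r') = \<Psi> z ` (ball z r') \<inter> piP)" ..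
  have "H \<subseteq> closure \<Omega>" using K by (auto simp: H')
  then have "lip_charts \<Omega> r' (L * A) H \<Psi>"
    unfolding lip_charts_def using ne cH \<Psi> by blast
  moreover have "\<forall>z\<in>bdry r' H \<Psi>. \<Psi> z ` (H \<inter> ball z r') = \<Psi> z ` (ball z r') \<inter> piP"
    unfolding bdry_def interior_pt_def using \<Psi> by blast
  ultimately show ?thesis unfolding classMR_def A_def by blast
qed

section \<open>Finite nets of uniform cardinality\<close>

text \<open>Translating by one of its points moves \<open>K\<close> into \<open>cball 0 d\<close>,
  which has a fixed finite cover by balls of radius \<open>\<epsilon>/2\<close>. Choosing a point of
  \<open>K\<close> in each ball that meets the translate gives centres in \<open>K\<close> at the
  cost of doubling the radius. Thus \<open>M\<close> is fixed before \<open>K\<close>.\<close>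

lemma uniform_finite_net:
  fixes d \<epsilon> :: real
  assumes "\<epsilon> > 0"
  obtains M :: nat where "\<And>K :: 'a::euclidean_space set. (\<And>x y. x \<in> K \<Longrightarrow> y \<in> K \<Longrightarrow> dist x y \<le> d) \<Longrightarrow>
    \<exists>X\<subseteq>K. finite X \<and> card X \<le> M \<and> K \<subseteq> (\<Union>x\<in>X. ball x \<epsilon>)"
proof -
  obtain k where k: "finite k" "cball (0::'a) d \<subseteq> (\<Union>x\<in>k. ball x (\<epsilon>/2))"
    using compact_cball[of "0::'a" d] assms unfolding compact_eq_totally_bounded by (metis half_gt_zero)
  show thesis
  proof (rule that[of "card k"])
    fix K :: "'a set" assume d: "\<And>x y. x \<in> K \<Longrightarrow> y \<in> K \<Longrightarrow> dist x y \<le> d"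
    show "\<exists>X\<subseteq>K. finite X \<and> card X \<le> card k \<and> K \<subseteq> (\<Union>x\<in>X. ball x \<epsilon>)"
    proof (cases "K = {}")
      case False
      then obtain x0 where x0: "x0 \<in> K" by blast
      define k' where "k' = {c \<in> k. \<exists>y\<in>K. y - x0 \<in> ball c (\<epsilon>/2)}"
      have "\<forall>c\<in>k'. \<exists>y. y \<in> K \<and> y - x0 \<in> ball c (\<epsilon>/2)" by (auto simp: k'_def)
      then obtain f where f: "\<And>c. c \<in> k' \<Longrightarrow> f c \<in> K \<and> f c - x0 \<in> ball c (\<epsilon>/2)" by metis
      have k': "k' \<subseteq> k" "finite k'" using k by (auto simp: k'_def)
      have "K \<subseteq> (\<Union>x\<in>f ` k'. ball x \<epsilon>)"
      proof
        fix y assume y: "y \<in> K"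
        then have "y - x0 \<in> cball 0 d" using d[OF y x0] by (simp add: dist_norm norm_minus_commute)
        then obtain c where c: "c \<in> k" "y - x0 \<in> ball c (\<epsilon>/2)" using k by blast
        then have "c \<in> k'" using y by (auto simp: k'_def)
        moreover have "dist (f c) y < \<epsilon>"
        proof -
          have "dist (f c) y = dist (f c - x0) (y - x0)" by (simp add: dist_norm)
          also have "\<dots> < \<epsilon>"
            by (rule dist_triangle_half_r[of c]) (use f[OF \<open>c \<in> k'\<close>] c(2) in auto)
          finally show ?thesis .
        qed
        ultimately show "y \<in> (\<Union>x\<in>f ` k'. ball x \<epsilon>)" by auto
      qed
      moreover have "card (f ` k') \<le> card k"
        using k k' by (meson card_image_le card_mono order_trans)
      moreover have "f ` k' \<subseteq> K" using f by auto
      ultimately show ?thesis using k' by (intro exI[of _ "f ` k'"]) auto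
    qed auto
  qed
qed

section \<open>Change of chart constants and coverage by a net of discs\<close>

lemma lip_charts_mono:
  assumes "lip_charts \<Omega> r L K \<Phi>" "0 < L" "r' \<le> r" "L \<le> L'"
  shows "lip_charts \<Omega> r' L' K \<Phi>"
proof -
  have K: "K \<noteq> {}" "compact K" "K \<subseteq> closure \<Omega>"
    and c: "\<And>x a b. x \<in> K \<Longrightarrow> a \<in> cball x r \<Longrightarrow> b \<in> cball x r \<Longrightarrow>
      dist a b / L \<le> dist (\<Phi> x a) (\<Phi> x b) \<and> dist (\<Phi> x a) (\<Phi> x b) \<le> L * dist a b"
    and z: "\<And>x. x \<in> K \<Longrightarrow> \<Phi> x x = 0" "\<And>x. x \<in> K \<Longrightarrow> \<Phi> x ` (K \<inter> ball x r) \<subseteq> piN"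
    using assms(1) unfolding lip_charts_def by blast+
  have "dist a b / L' \<le> dist (\<Phi> x a) (\<Phi> x b) \<and> dist (\<Phi> x a) (\<Phi> x b) \<le> L' * dist a b"
    if "x \<in> K" "a \<in> cball x r'" "b \<in> cball x r'" for x a b
  proof -
    have *: "dist a b / L \<le> dist (\<Phi> x a) (\<Phi> x b)" "dist (\<Phi> x a) (\<Phi> x b) \<le> L * dist a b"
      using c[of x a b] that assms(3) by auto
    have "dist a b / L' \<le> dist a b / L"
      using assms by (intro divide_left_mono mult_pos_pos) auto
    moreover have "L * dist a b \<le> L' * dist a b" using assms by (intro mult_right_mono) auto
    ultimately show ?thesis using * by linarith
  qed
  moreover have "\<Phi> x ` (K \<inter> ball x r') \<subseteq> piN" if "x \<in> K" for x
  proof -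
    have "K \<inter> ball x r' \<subseteq> K \<inter> ball x r" using assms(3) by auto
    then show ?thesis using z(2)[OF that] by blast
  qed
  ultimately show ?thesis unfolding lip_charts_def using K z(1) by blast
qed

text \<open>Shrinking the cone at \<open>y\<close> towards \<open>\<Phi> x y\<close> by a factor \<open>t\<close> keeps it inside the chart; the
  ball inside the shrunken cone contains a ball centred at one of the net points \<open>A\<close>, and by
  convexity \<open>\<Phi> x y\<close> is seen from that ball.\<close>
lemma chart_point_seen_from_net:
  fixes \<phi> :: "real^('n::{finite,linorder}) \<Rightarrow> real^('n::{finite,linorder})"
  assumes rL: "0 < r" "0 < L"
    and lo: "\<And>a b. a \<in> cball x r \<Longrightarrow> b \<in> cball x r \<Longrightarrow> dist a b \<le> L * dist (\<phi> a) (\<phi> b)"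
    and up: "\<And>a b. a \<in> cball x r \<Longrightarrow> b \<in> cball x r \<Longrightarrow> dist (\<phi> a) (\<phi> b) \<le> L * dist a b"
    and \<phi>0: "\<phi> x = 0"
    and y: "y \<in> ball x (r/2)"
    and Cy: "convex Cy" "\<phi> y \<in> Cy" "Cy \<subseteq> \<phi> ` (cball x r \<inter> K)" "Cy \<subseteq> piN"
    and p: "p \<in> piN" "cball p s0 \<inter> piN \<subseteq> Cy" "0 < s0"
    and D: "\<And>u v. u \<in> Cy \<Longrightarrow> v \<in> Cy \<Longrightarrow> dist u v \<le> D"
    and t: "0 < t" "t \<le> 1" "L * (t * D) \<le> r / 4"
    and A: "cball 0 (L * r + t * D) \<inter> piN \<subseteq> (\<Union>q\<in>A. ball q (t * s0 / 2))"
  shows "\<exists>q\<in>A. \<phi> y \<in> seen_from (cball q (t * s0 / 2) \<inter> piN) (\<phi> ` (K \<inter> cball x (3*r/4)))"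
proof -
  \<comment> \<open>The homothety with centre \<open>\<phi> y\<close> and ratio \<open>t\<close>
    takes the disc of radius \<open>s0\<close> about \<open>p\<close> to one of radius
    \<open>t * s0\<close> about \<open>pt\<close>. A net point within half that radius leaves the
    other half for its own disc.\<close>
  define pt where "pt = \<phi> y + t *\<^sub>R (p - \<phi> y)"
  have ypi: "\<phi> y \<in> piN" using Cy by blast
  have pC: "p \<in> Cy" using p by auto
  have ptpi: "pt \<in> piN" unfolding pt_def using ypi p
    by (intro subspace_add subspace_scale subspace_diff subspace_piN)
  have "norm (\<phi> y) \<le> L * r"
  proof -
    have "norm (\<phi> y) = dist (\<phi> y) (\<phi> x)" using \<phi>0 by simp
    also have "\<dots> \<le> L * dist y x" using y rL by (intro up) auto
    also have "\<dots> \<le> L * r" using y rL by (simp add: dist_commute)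
    finally show ?thesis .
  qed
  moreover have "norm (t *\<^sub>R (p - \<phi> y)) \<le> t * D"
    using D[OF pC Cy(2)] t by (simp add: dist_norm)
  ultimately have "norm pt \<le> L * r + t * D"
    unfolding pt_def using norm_triangle_ineq[of "\<phi> y" "t *\<^sub>R (p - \<phi> y)"] by linarith
  then obtain q where q: "q \<in> A" "dist q pt < t * s0 / 2" using A ptpi by (auto simp: subset_iff)
  have "closed_segment (\<phi> y) b \<subseteq> \<phi> ` (K \<inter> cball x (3*r/4))"
    if b: "b \<in> cball q (t * s0 / 2) \<inter> piN" for b
  proof
    fix v assume "v \<in> closed_segment (\<phi> y) b"
    then obtain u where u: "0 \<le> u" "u \<le> 1" "v = (1 - u) *\<^sub>R \<phi> y + u *\<^sub>R b"
      by (auto simp: in_segment)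
    \<comment> \<open>The inverse homothety brings \<open>b\<close> back into the original disc,
      hence into \<open>Cy\<close>.\<close>
    define c where "c = \<phi> y + (1 / t) *\<^sub>R (b - \<phi> y)"
    have cpi: "c \<in> piN" unfolding c_def using ypi b
      by (intro subspace_add subspace_scale subspace_diff subspace_piN) auto
    have "c - p = (1 / t) *\<^sub>R (b - pt)"
      using t by (simp add: c_def pt_def algebra_simps)
    then have "dist c p = dist b pt / t" using t by (simp add: dist_norm)
    also have "\<dots> \<le> s0"
    proof -
      have "dist b pt \<le> t * s0"
        using q(2) b dist_triangle[of b pt q] by (simp add: dist_commute)
      then show ?thesis using t by (simp add: field_simps)
    qed
    finally have c: "c \<in> Cy" using p cpi by (auto simp: dist_commute)
    have v: "v = (1 - u * t) *\<^sub>R \<phi> y + (u * t) *\<^sub>R c"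
      using t by (simp add: u(3) c_def algebra_simps)
    have ut: "0 \<le> u * t" "u * t \<le> 1" using u t by (auto simp: mult_le_one)
    have vC: "v \<in> Cy" unfolding v using Cy(1,2) c ut by (intro convexD) auto
    then obtain z where z: "z \<in> cball x r" "z \<in> K" "v = \<phi> z" using Cy(3) by blast
    \<comment> \<open>The shrunken segment stays within \<open>t * D\<close> of
      \<open>\<phi> y\<close>, so preimages stay within \<open>r / 4\<close> of \<open>y\<close>,
      which itself is within \<open>r / 2\<close> of \<open>x\<close>; this explains the radius
      \<open>3*r/4\<close>.\<close>
    have "v - \<phi> y = (u * t) *\<^sub>R (c - \<phi> y)" unfolding v by (simp add: algebra_simps)
    then have "dist v (\<phi> y) = (u * t) * dist c (\<phi> y)" using ut by (simp add: dist_norm)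
    also have "\<dots> \<le> t * D"
      using D[OF c Cy(2)] u t by (intro mult_mono) (auto simp: mult_left_le_one_le)
    finally have "L * dist (\<phi> z) (\<phi> y) \<le> r / 4"
      using z(3) rL t(3) by (smt (verit) mult_left_mono)
    moreover have "dist z y \<le> L * dist (\<phi> z) (\<phi> y)" using z y rL by (intro lo) auto
    ultimately have "dist x z \<le> 3 * r / 4"
      using y dist_triangle[of x z y] by (simp add: dist_commute)
    then show "v \<in> \<phi> ` (K \<inter> cball x (3*r/4))" using z by auto
  qed
  then show ?thesis using q(1) unfolding seen_from_def by blast
qed

section \<open>Choice of constants and decomposition of the hypersurface\<close>

theorem theoremA8:
  fixes r L :: real and C :: "(real^('n::{finite,linorder})) set"
  assumes "CARD('n::{finite,linorder}) \<ge> 2"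
    and "r > 0" and "L > 0"
    and "pi_cone0 C"
  shows "\<exists>r'>0. \<exists>L'>0. \<forall>d. \<exists>M0::nat. \<forall>\<Omega> :: (real^('n::{finite,linorder})) set.
           open \<Omega> \<and> bounded \<Omega> \<and> diameter \<Omega> = d \<longrightarrow>
           (\<forall>K. classG \<Omega> r L C K \<longrightarrow> classFR \<Omega> r' L' M0 K)"
proof -
  obtain p0 s0 D where C: "0 < s0" "0 < D" "C \<subseteq> piN" "convex C" "p0 \<in> piN" "cball p0 s0 \<inter> piN \<subseteq> C"
    and CD: "\<And>u v. u \<in> C \<Longrightarrow> v \<in> C \<Longrightarrow> dist u v \<le> D"
    using pi_cone0_props[OF assms(4)] by metis
  define t where "t = min 1 (r / (4 * L * D))"
  have "t \<le> r / (4 * L * D)" by (simp add: t_def)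
  then have t: "L * (t * D) \<le> r / 4" using assms C by (simp add: field_simps)
  have t01: "0 < t" "t \<le> 1" using assms C by (auto simp: t_def)
  define s where "s = t * s0 / 2"
  define R1 where "R1 = L * r + t * D"
  define r' where "r' = min (r / 8) (s / (2 * L))"
  define A where "A = 2 + 2 * (L * r + R1) / s"
  have s: "s > 0" using t01 C by (simp add: s_def)
  have r': "r' > 0" "r' \<le> r / 8" "L * r' \<le> s / 2"
  proof -
    have "r' \<le> s / (2 * L)" by (simp add: r'_def)
    then show "L * r' \<le> s / 2" using assms(3) by (simp add: field_simps)
  qed (use s assms in \<open>auto simp: r'_def\<close>)
  have "R1 > 0" using assms C t01 by (simp add: R1_def add_pos_pos)
  then have A: "A \<ge> 2" using assms s by (simp add: A_def)
  \<comment> \<open>The net of disc centres lives in the model hyperplane, so one \<open>N\<close>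
    serves all charts, all \<open>K\<close> and all \<Omega>. \<open>R1\<close> bounds the centres
    of the shrunken discs.\<close>
  have "compact (cball 0 R1 \<inter> piN :: (real^('n::{finite,linorder})) set)"
    by (intro compact_Int_closed compact_cball closed_piN)
  then have "\<exists>N. finite N \<and> N \<subseteq> cball 0 R1 \<inter> piN \<and>
      (cball 0 R1 \<inter> piN :: (real^('n::{finite,linorder})) set) \<subseteq> (\<Union>q\<in>N. ball q s)"
    using s by (intro seq_compact_imp_totally_bounded[rule_format]) (auto simp: compact_eq_seq_compact_metric)
  then obtain N :: "(real^('n::{finite,linorder})) set" where N: "finite N" "N \<subseteq> cball 0 R1 \<inter> piN"
    "cball 0 R1 \<inter> piN \<subseteq> (\<Union>q\<in>N. ball q s)"
    by blast
  have "\<exists>M0::nat. \<forall>\<Omega> :: (real^('n::{finite,linorder})) set.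
      open \<Omega> \<and> bounded \<Omega> \<and> diameter \<Omega> = d \<longrightarrow> (\<forall>K. classG \<Omega> r L C K \<longrightarrow> classFR \<Omega> r' (L * A) M0 K)" for d
  proof -
    have "r / 2 > 0" using assms by simp
    then obtain M where M: "\<And>K :: (real^('n::{finite,linorder})) set. (\<And>x y. x \<in> K \<Longrightarrow> y \<in> K \<Longrightarrow> dist x y \<le> d) \<Longrightarrow>
      \<exists>X\<subseteq>K. finite X \<and> card X \<le> M \<and> K \<subseteq> (\<Union>x\<in>X. ball x (r/2))"
      using uniform_finite_net[where 'a = "real^('n::{finite,linorder})" and d = d] by metis
    show ?thesis
    proof (intro exI[of _ "M * card N"] allI impI)
      fix \<Omega> K :: "(real^('n::{finite,linorder})) set"
      assume \<Omega>: "open \<Omega> \<and> bounded \<Omega> \<and> diameter \<Omega> = d" and "classG \<Omega> r L C K"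
      then obtain \<Phi> where \<Phi>: "lip_charts \<Omega> r L K \<Phi>"
        and cones: "\<And>x y. x \<in> K \<Longrightarrow> y \<in> ball x (r/2) \<inter> K \<Longrightarrow> \<exists>Cy. Cy \<subseteq> piN \<and> congruent_sets Cy C \<and>
         \<Phi> x y \<in> Cy \<and> Cy \<subseteq> \<Phi> x ` (cball x r \<inter> K)"
        unfolding classG_def by blast
      have K: "K \<noteq> {}" "compact K" "K \<subseteq> closure \<Omega>"
        and bl: "\<And>x a b. x \<in> K \<Longrightarrow> a \<in> cball x r \<Longrightarrow> b \<in> cball x r \<Longrightarrow>
          dist a b / L \<le> dist (\<Phi> x a) (\<Phi> x b) \<and> dist (\<Phi> x a) (\<Phi> x b) \<le> L * dist a b"
        and \<Phi>0: "\<And>x. x \<in> K \<Longrightarrow> \<Phi> x x = 0" and \<Phi>pi: "\<And>x. x \<in> K \<Longrightarrow> \<Phi> x ` (K \<inter> ball x r) \<subseteq> piN"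
        using \<Phi> unfolding lip_charts_def by blast+
      have up: "dist (\<Phi> x a) (\<Phi> x b) \<le> L * dist a b" and lo: "dist a b \<le> L * dist (\<Phi> x a) (\<Phi> x b)"
        if "x \<in> K" "a \<in> cball x r" "b \<in> cball x r" for x a b
        using bl[OF that] assms(3) by (simp_all add: pos_divide_le_eq mult.commute)
      \<comment> \<open>The diameter enters only here: it bounds the number of chart centres by
        \<open>M\<close>, and each centre contributes at most \<open>card N\<close> pieces.\<close>
      have "dist x y \<le> d" if "x \<in> K" "y \<in> K" for x y
        using that K(3) \<Omega> diameter_bounded_bound[of "closure \<Omega>" x y]
        by (auto simp: diameter_closure bounded_closure)
      then obtain X where X: "X \<subseteq> K" "finite X" "card X \<le> M" "K \<subseteq> (\<Union>x\<in>X. ball x (r/2))"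
        using M by metis
      define H where "H x q = {z \<in> K \<inter> cball x (3*r/4).
        \<Phi> x z \<in> seen_from (cball q s \<inter> piN) (\<Phi> x ` (K \<inter> cball x (3*r/4)))}" for x q
      \<comment> \<open>Empty pieces are discarded because hypersurfaces are nonempty by
        definition.\<close>
      define \<H> where "\<H> = (\<lambda>(x, q). H x q) ` (X \<times> N) - {{}}"
      have fin: "finite \<H>" using X N by (simp add: \<H>_def)
      have "card \<H> \<le> card ((\<lambda>(x, q). H x q) ` (X \<times> N))"
        unfolding \<H>_def using X N by (intro card_mono) auto
      also have "\<dots> \<le> card (X \<times> N)" using X N by (intro card_image_le) auto
      also have "\<dots> \<le> M * card N" using X by (simp add: card_cartesian_product)
      finally have cardH: "card \<H> \<le> M * card N" .
      have MR: "classMR \<Omega> r' (L * A) h" if h: "h \<in> \<H>" for h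
      proof -
        obtain x q where xq: "x \<in> X" "q \<in> N" "h = H x q" "h \<noteq> {}" using h by (auto simp: \<H>_def)
        then have "x \<in> K" using X by blast
        show ?thesis
          unfolding A_def
        proof (rule pullback_of_star_shaped_in_classMR[OF assms(1-3) K(2,3) lo up])
          show "\<Phi> x x = 0" "\<Phi> x ` (K \<inter> ball x r) \<subseteq> piN" using \<Phi>0 \<Phi>pi \<open>x \<in> K\<close> by auto
          show "q \<in> piN" "norm q \<le> R1" using N xq by auto
        qed (use \<open>x \<in> K\<close> s r' xq in \<open>auto simp: H_def\<close>)
      qed
      have "K \<subseteq> \<Union>\<H>"
      proof
        fix y assume y: "y \<in> K"
        then obtain x where x: "x \<in> X" "y \<in> ball x (r/2)" using X by blast
        then have xK: "x \<in> K" using X by blast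
        obtain Cy where Cy: "Cy \<subseteq> piN" "congruent_sets Cy C" "\<Phi> x y \<in> Cy" "Cy \<subseteq> \<Phi> x ` (cball x r \<inter> K)"
          using cones[OF xK] x y by blast
        note cong = congruent_in_piN[OF C(3,4,5,1,6) Cy(1,2)]
        obtain p where p: "p \<in> piN" "cball p s0 \<inter> piN \<subseteq> Cy" using cong(2) by blast
        have CyD: "dist u v \<le> D" if "u \<in> Cy" "v \<in> Cy" for u v
          using Cy(2) CD that unfolding congruent_sets_def by (metis imageI)
        have "\<exists>q\<in>N. \<Phi> x y \<in> seen_from (cball q s \<inter> piN) (\<Phi> x ` (K \<inter> cball x (3*r/4)))"
          unfolding s_def
          by (rule chart_point_seen_from_net[where Cy = Cy and p = p and D = D and L = L])
            (use assms lo[OF xK] up[OF xK] \<Phi>0[OF xK] x cong(1) Cy p C CyD t t01 N in \<open>auto simp: R1_def s_def\<close>)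
        then obtain q where q: "q \<in> N"
          "\<Phi> x y \<in> seen_from (cball q s \<inter> piN) (\<Phi> x ` (K \<inter> cball x (3*r/4)))" by blast
        have "dist x y \<le> 3 * r / 4" using x assms by simp
        then have "y \<in> H x q" using q y by (simp add: H_def)
        then show "y \<in> \<Union>\<H>" using x q by (auto simp: \<H>_def)
      qed
      moreover have "\<Union>\<H> \<subseteq> K" by (auto simp: \<H>_def H_def)
      ultimately have KH: "K = \<Union>\<H>" by blast
      obtain h where h: "bij_betw h {..<card \<H>} \<H>"
        using ex_bij_betw_nat_finite[OF fin] by (auto simp: atLeast0LessThan)
      have "\<H> \<noteq> {}" using K KH by auto
      then have "1 \<le> card \<H>" using fin by (simp add: Suc_le_eq card_gt_0_iff)
      moreover have "K = (\<Union>j<card \<H>. h j)" using KH h by (simp add: bij_betw_def)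
      moreover have "\<forall>j<card \<H>. classMR \<Omega> r' (L * A) (h j)"
        using MR h by (auto simp: bij_betw_def)
      moreover have "lip_charts \<Omega> r' (L * A) K \<Phi>"
        using \<Phi> assms r' A by (intro lip_charts_mono[OF \<Phi>]) auto
      ultimately show "classFR \<Omega> r' (L * A) (M * card N) K"
        unfolding classFR_def using cardH by blast
    qed
  qed
  moreover have "L * A > 0" using assms A by simp
  ultimately show ?thesis using r'(1) by blast
qed

end
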